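(* Let $H$ be a complex Hilbert space and let $A,B\in\mathscr{B}(H)$ be bounded positive operators. With the Hilbert spaces $H_A,H_B$, the operators $\widetilde{J}_A,\widetilde{J}_B:H_A\times H_B\to H$ and the orthogonal projection $P$ of $H_A\times H_B$ defined in the context, $\widetilde{J}_AP\widetilde{J}_A^*$ and $\widetilde{J}_BP\widetilde{J}_B^*$ are bounded positive operators on $H$ with the same quadratic form, given by $$\inf\{(A(x-y)\mid x-y)+(By\mid y) : y\in H\},\qquad x\in H.$$ In particular, $\widetilde{J}_AP\widetilde{J}_A^*=\widetilde{J}_BP\widetilde{J}_B^*$.
   Context: Inner products $(\cdot\mid\cdot)$ are linear in the first variable. $\mathscr{B}(H)$ is the algebra of bounded linear operators on $H$; $A\in\mathscr{B}(H)$ is positive if $(Ax\mid x)\ge 0$ for all $x\in H$, and its quadratic form is $x\mapsto (Ax\mid x)$. For a positive $A\in\mathscr{B}(H)$, the range $\operatorname{ran}A$ is equipped with the inner product $(Ax\mid Ay)_A:=(Ax\mid y)$, $x,y\in H$, and $H_A$ denotes the Hilbert space completion of this inner product space. $H_B$ is defined analogously from $B$. $H_A\times H_B$ is the product (direct sum) Hilbert space. The operators $J,\widetilde{J}_A,\widetilde{J}_B$ from $H_A\times H_B$ to $H$ are the unique continuous linear extensions of $$J(Ax,By):=Ax+By,\qquad \widetilde{J}_A(Ax,By):=Ax,\qquad \widetilde{J}_B(Ax,By):=By,\qquad x,y\in H$$ (these are bounded on the dense subspace $\operatorname{ran}A\times\operatorname{ran}B$). Their adjoints satisfy $J^*x=(Ax,Bx)$,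 $\widetilde{J}_A^*x=(Ax,0)$, $\widetilde{J}_B^*x=(0,Bx)$ for $x\in H$. $P$ is the orthogonal projection of $H_A\times H_B$ onto the orthogonal complement $\{\operatorname{ran}J^*\}^{\perp}$. *)

theory Defs
  imports "HOL-Analysis.Analysis"
begin

section \<open>Complex Hilbert spaces\<close>

text \<open>
  A complex inner product space carries the real inner product \<open>Re (x | y)\<close>, which induces the
  same norm.  Building on \<^class>\<open>real_inner\<close> therefore loses no generality, and it supplies norm,
  metric and topology.  The complex inner product is linear in its first argument.
\<close>

class complex_inner = real_inner +
  fixes scaleC :: "complex \<Rightarrow> 'a \<Rightarrow> 'a" (infixr "*\<^sub>C" 75)
    and cinner :: "'a \<Rightarrow> 'a \<Rightarrow> complex"
  assumes scaleC_add_right: "c *\<^sub>C (x + y) = c *\<^sub>C x + c *\<^sub>C y"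
    and scaleC_add_left: "(c + d) *\<^sub>C x = c *\<^sub>C x + d *\<^sub>C x"
    and scaleC_scaleC: "c *\<^sub>C d *\<^sub>C x = (c * d) *\<^sub>C x"
    and scaleC_of_real: "complex_of_real r *\<^sub>C x = r *\<^sub>R x"
    and cinner_commute: "cinner x y = cnj (cinner y x)"
    and cinner_add_left: "cinner (x + y) z = cinner x z + cinner y z"
    and cinner_scaleC_left: "cinner (c *\<^sub>C x) y = c * cinner x y"
    and Re_cinner: "Re (cinner x y) = inner x y"

class chilbert_space = complex_inner + complete_space

instantiation complex :: complex_inner
begin

definition scaleC_complex :: "complex \<Rightarrow> complex \<Rightarrow> complex" where
  "scaleC_complex c x = c * x"

definition cinner_complex :: "complex \<Rightarrow> complex \<Rightarrow> complex" where
  "cinner_complex x y = x * cnj y"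

instance
  by standard
    (simp_all add: scaleC_complex_def cinner_complex_def algebra_simps scaleR_conv_of_real
      inner_complex_def)

end

instance complex :: chilbert_space ..

instantiation prod :: (complex_inner, complex_inner) complex_inner
begin

definition scaleC_prod :: "complex \<Rightarrow> 'a \<times> 'b \<Rightarrow> 'a \<times> 'b" where
  "scaleC_prod c z = (c *\<^sub>C fst z, c *\<^sub>C snd z)"

definition cinner_prod :: "'a \<times> 'b \<Rightarrow> 'a \<times> 'b \<Rightarrow> complex" where
  "cinner_prod z w = cinner (fst z) (fst w) + cinner (snd z) (snd w)"

instance
proof
  fix z w :: "'a \<times> 'b"
  show "cinner z w = cnj (cinner w z)"
    unfolding cinner_prod_def by (metis cinner_commute complex_cnj_add)
qed (simp_all add: scaleC_prod_def cinner_prod_def scaleC_add_right scaleC_add_left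
      scaleC_scaleC scaleC_of_real cinner_add_left cinner_scaleC_left Re_cinner inner_prod_def
      algebra_simps scaleR_prod_def)

end

instance prod :: (chilbert_space, chilbert_space) chilbert_space ..


section \<open>Operators\<close>

definition clinear_on :: "'a::complex_inner set \<Rightarrow> ('a \<Rightarrow> 'b::complex_inner) \<Rightarrow> bool" where
  "clinear_on S T \<longleftrightarrow>
     (\<forall>x\<in>S. \<forall>y\<in>S. T (x + y) = T x + T y) \<and> (\<forall>c. \<forall>x\<in>S. T (c *\<^sub>C x) = c *\<^sub>C T x)"

definition bounded_clinear :: "('a::complex_inner \<Rightarrow> 'b::complex_inner) \<Rightarrow> bool" where
  "bounded_clinear T \<longleftrightarrow> bounded_linear T \<and> (\<forall>c x. T (c *\<^sub>C x) = c *\<^sub>C T x)"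

text \<open>Membership in \<^term>\<open>\<real>\<^sub>\<ge>\<^sub>0\<close> says that the complex number is real and nonnegative.\<close>

definition positive_operator :: "('a::complex_inner \<Rightarrow> 'a) \<Rightarrow> bool" where
  "positive_operator T \<longleftrightarrow> (\<forall>x. cinner (T x) x \<in> \<real>\<^sub>\<ge>\<^sub>0)"

definition quadratic_form :: "('a::complex_inner \<Rightarrow> 'a) \<Rightarrow> 'a \<Rightarrow> complex" where
  "quadratic_form T x = cinner (T x) x"

text \<open>
  Hilbert spaces that depend on an operator cannot be types, so they are represented as closed
  complex subspaces \<open>K\<close> of a Hilbert space type.  An operator on \<open>K\<close> is a function that matters
  only on \<open>K\<close>.
\<close>

text \<open>The adjoint of an operator \<open>T\<close> from the Hilbert space \<open>K\<close> to the whole type \<open>'b\<close>.\<close>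

definition adjoint_on :: "'a::complex_inner set \<Rightarrow> ('a \<Rightarrow> 'b::complex_inner) \<Rightarrow> 'b \<Rightarrow> 'a" where
  "adjoint_on K T = (THE S. \<forall>y. S y \<in> K \<and> (\<forall>z\<in>K. cinner (T z) y = cinner z (S y)))"

text \<open>The orthogonal complement of \<open>M\<close> relative to \<open>K\<close>.\<close>

definition orth_compl_on :: "'a::complex_inner set \<Rightarrow> 'a set \<Rightarrow> 'a set" where
  "orth_compl_on K M = {z \<in> K. \<forall>w\<in>M. cinner z w = 0}"

definition orth_projection :: "'a::complex_inner set \<Rightarrow> 'a \<Rightarrow> 'a" where
  "orth_projection N z = (THE p. p \<in> N \<and> (\<forall>w\<in>N. cinner (z - p) w = 0))"


section \<open>The completions and the operators between them\<close>

text \<open>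
  The Hilbert space \<open>HA\<close>, with the canonical map \<open>i\<close> from \<^term>\<open>range A\<close> into it, is a completion
  of \<^term>\<open>range A\<close> for the inner product \<open>(A x | A y)\<^sub>A = (A x | y)\<close>: the map is linear and isometric
  with dense range.  Completeness of \<open>HA\<close> holds because it is closed in a Hilbert space.  Only the
  values of \<open>i\<close> on \<^term>\<open>range A\<close> are relevant.
\<close>

definition range_completion ::
    "('h::chilbert_space \<Rightarrow> 'h) \<Rightarrow> ('h \<Rightarrow> 'k::chilbert_space) \<Rightarrow> 'k set \<Rightarrow> bool" where
  "range_completion A i HA \<longleftrightarrow>
     clinear_on (range A) i \<and>
     (\<forall>x y. cinner (i (A x)) (i (A y)) = cinner (A x) y) \<and>
     HA = closure (i ` range A)"

text \<open>
  The continuous linear operator \<open>T\<close> on \<open>HA \<times> HB\<close> with \<open>T (A x, B y) = f x y\<close> for all \<open>x\<close>, \<open>y\<close>.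
  Requiring \<open>T\<close> to be \<^const>\<open>extensional\<close> fixes its irrelevant values outside \<open>HA \<times> HB\<close>, so that the
  description is unique.
\<close>

definition cont_linear_ext ::
    "('h::chilbert_space \<Rightarrow> 'h) \<Rightarrow> ('h \<Rightarrow> 'ka::chilbert_space) \<Rightarrow> 'ka set \<Rightarrow>
     ('h \<Rightarrow> 'h) \<Rightarrow> ('h \<Rightarrow> 'kb::chilbert_space) \<Rightarrow> 'kb set \<Rightarrow>
     ('h \<Rightarrow> 'h \<Rightarrow> 'h) \<Rightarrow> 'ka \<times> 'kb \<Rightarrow> 'h" where
  "cont_linear_ext A i HA B j HB f =
     (THE T. T \<in> extensional (HA \<times> HB) \<and> clinear_on (HA \<times> HB) T \<and> continuous_on (HA \<times> HB) T \<and>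
        (\<forall>x y. T (i (A x), j (B y)) = f x y))"

definition J_op where
  "J_op A i HA B j HB = cont_linear_ext A i HA B j HB (\<lambda>x y. A x + B y)"

definition JA_op where
  "JA_op A i HA B j HB = cont_linear_ext A i HA B j HB (\<lambda>x y. A x)"

definition JB_op where
  "JB_op A i HA B j HB = cont_linear_ext A i HA B j HB (\<lambda>x y. B y)"

definition P_op where
  "P_op A i HA B j HB =
     orth_projection
       (orth_compl_on (HA \<times> HB) (range (adjoint_on (HA \<times> HB) (J_op A i HA B j HB))))"

definition JPJ_A where
  "JPJ_A A i HA B j HB =
     JA_op A i HA B j HB \<circ> P_op A i HA B j HB \<circ> adjoint_on (HA \<times> HB) (JA_op A i HA B j HB)"

definition JPJ_B where
  "JPJ_B A i HA B j HB =
     JB_op A i HA B j HB \<circ> P_op A i HA B j HB \<circ> adjoint_on (HA \<times> HB) (JB_op A i HA B j HB)"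

end

theory Submission
  imports Defs
begin

text \<open>
  Put \<open>V x = i (A x)\<close> and \<open>W x = j (B x)\<close>.  The adjoint of the first operator of the context is
  \<open>S x = (V x, W x)\<close>, and those of the other two are \<open>x \<mapsto> (V x, 0)\<close> and \<open>x \<mapsto> (0, W x)\<close>.
  Since \<open>P\<close> annihilates the range of \<open>S\<close>, it sends \<open>(V x, 0)\<close> to the negative of the image of
  \<open>(0, W x)\<close>, so both products have the sesquilinear form \<open>(P (V x, 0) | P (V y, 0))\<close>.  Its
  quadratic form is the squared distance from \<open>(V x, 0)\<close> to the range of \<open>S\<close>, and
  \<open>\<parallel>(V x, 0) - S y\<parallel>\<^sup>2 = (A (x - y) | x - y) + (B y | y)\<close>.
\<close>

section \<open>Complex inner product spaces\<close>

lemma cinner_add_right: "cinner x (y + z) = cinner x y + cinner x z"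
  by (metis cinner_add_left cinner_commute complex_cnj_add)

lemma cinner_scaleC_right: "cinner x (c *\<^sub>C y) = cnj c * cinner x y"
  by (metis cinner_scaleC_left cinner_commute complex_cnj_mult)

lemma cinner_minus_left: "cinner (- x) y = - cinner x y"
  using cinner_add_left[of x "- x" y] cinner_add_left[of 0 0 y]
  by (simp add: eq_neg_iff_add_eq_0 add.commute)

lemma cinner_diff_left: "cinner (x - y) z = cinner x z - cinner y z"
  using cinner_add_left[of x "- y" z] by (simp add: cinner_minus_left)

lemma cinner_zero_left [simp]: "cinner 0 y = 0"
  using cinner_diff_left[of y y y] by simp

lemma cinner_zero_right [simp]: "cinner x 0 = 0"
  using cinner_add_right[of x 0 0] by simp

lemma cinner_minus_right: "cinner x (- y) = - cinner x y"
  by (metis cinner_minus_left cinner_commute complex_cnj_minus)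

lemma cinner_diff_right: "cinner x (y - z) = cinner x y - cinner x z"
  using cinner_add_right[of x y "- z"] by (simp add: cinner_minus_right)

lemma scaleC_zero_right [simp]: "c *\<^sub>C (0::'a::complex_inner) = 0"
  using scaleC_add_right[of c "0::'a" 0] by simp

lemma scaleC_diff_right: "c *\<^sub>C (x - y) = c *\<^sub>C x - c *\<^sub>C (y::'a::complex_inner)"
  using scaleC_add_right[of c "x - y" y] by simp

text \<open>Conjugate linearity in the second slot turns the real part at
  \<open>\<i> *\<^sub>C y\<close> into the imaginary part at \<open>y\<close>. Facts about the real
  inner product, such as continuity, thereby transfer to \<open>cinner\<close>.\<close>

lemma cinner_eq_inner:
  "cinner x y = complex_of_real (inner x y) + \<i> * complex_of_real (inner x (\<i> *\<^sub>C y))"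
proof -
  have "inner x (\<i> *\<^sub>C y) = Im (cinner x y)"
    by (simp flip: Re_cinner add: cinner_scaleC_right)
  then show ?thesis
    by (simp flip: Re_cinner add: complex_eq)
qed

lemma cinner_self: "cinner x x = complex_of_real ((norm x)\<^sup>2)"
proof -
  have "Im (cinner x x) = 0"
    using cinner_commute[of x x] by (simp add: complex_eq_iff)
  then show ?thesis
    by (simp add: complex_eq_iff Re_cinner power2_norm_eq_inner)
qed

lemma cinner_self_eq_0 [simp]: "cinner x x = 0 \<longleftrightarrow> x = 0"
  by (simp add: cinner_self)

text \<open>The difference of the two vectors is orthogonal to itself. Operator identities below are
  checked by pairing with an arbitrary vector.\<close>

lemma cinner_ext:
  assumes "\<And>y. cinner x y = cinner x' y"
  shows "x = x'"
  using assms[of "x - x'"] cinner_self_eq_0[of "x - x'"] by (simp add: cinner_diff_left)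

lemma cinner_orthogonal_sym: "cinner x y = 0 \<Longrightarrow> cinner y x = 0"
  by (metis cinner_commute complex_cnj_zero)

lemma norm_scaleC: "norm (c *\<^sub>C x) = cmod c * norm (x::'a::complex_inner)"
proof -
  have "complex_of_real ((norm (c *\<^sub>C x))\<^sup>2) = complex_of_real ((cmod c * norm x)\<^sup>2)"
    unfolding cinner_self[symmetric] cinner_scaleC_left cinner_scaleC_right
    by (simp add: cinner_self power_mult_distrib algebra_simps)
      (metis complex_norm_square of_real_power)
  then have "(norm (c *\<^sub>C x))\<^sup>2 = (cmod c * norm x)\<^sup>2"
    using of_real_eq_iff by blast
  then show ?thesis
    by simp
qed

lemma bounded_linear_scaleC: "bounded_linear (\<lambda>x::'a::complex_inner. c *\<^sub>C x)"
proof (rule bounded_linear_intro)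
  show "c *\<^sub>C r *\<^sub>R x = r *\<^sub>R c *\<^sub>C x" for r and x :: 'a
    by (metis scaleC_of_real scaleC_scaleC mult.commute)
  show "norm (c *\<^sub>C x) \<le> norm x * cmod c" for x :: 'a
    by (simp add: norm_scaleC)
qed (rule scaleC_add_right)

lemma continuous_on_cinner_left: "continuous_on S (\<lambda>x. cinner x y)"
  unfolding cinner_eq_inner by (intro continuous_intros)

section \<open>Complex subspaces and the projection theorem\<close>

text \<open>Splitting off the real \<open>subspace\<close> makes the real theory of subspaces, in
  particular the minimization over a closed real subspace, directly applicable.\<close>

definition csubspace :: "'a::complex_inner set \<Rightarrow> bool" where
  "csubspace S \<longleftrightarrow> subspace S \<and> (\<forall>c. \<forall>x\<in>S. c *\<^sub>C x \<in> S)"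

lemma csubspaceI:
  assumes "0 \<in> S" "\<And>x y. x \<in> S \<Longrightarrow> y \<in> S \<Longrightarrow> x + y \<in> S" "\<And>c x. x \<in> S \<Longrightarrow> c *\<^sub>C x \<in> S"
  shows "csubspace S"
  using assms unfolding csubspace_def subspace_def by (metis scaleC_of_real)

lemma csubspace_0: "csubspace S \<Longrightarrow> 0 \<in> S"
  and csubspace_add: "csubspace S \<Longrightarrow> x \<in> S \<Longrightarrow> y \<in> S \<Longrightarrow> x + y \<in> S"
  and csubspace_diff: "csubspace S \<Longrightarrow> x \<in> S \<Longrightarrow> y \<in> S \<Longrightarrow> x - y \<in> S"
  and csubspace_scaleC: "csubspace S \<Longrightarrow> x \<in> S \<Longrightarrow> c *\<^sub>C x \<in> S"
  by (auto simp: csubspace_def subspace_0 subspace_add subspace_diff)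

lemma csubspace_UNIV: "csubspace UNIV"
  by (rule csubspaceI) auto

lemma csubspace_Times:
  assumes "csubspace S" "csubspace T"
  shows "csubspace (S \<times> T)"
  using assms
  by (intro csubspaceI) (auto simp: scaleC_prod_def zero_prod_def
      csubspace_0 csubspace_add csubspace_scaleC)

text \<open>A continuous map that sends a set into \<open>closure S\<close> also sends the closure
  of that set there.\<close>

lemma csubspace_closure:
  assumes "csubspace S"
  shows "csubspace (closure S)"
proof -
  have "c *\<^sub>C x \<in> closure S" if "x \<in> closure S" for c x
  proof -
    have "(\<lambda>x. c *\<^sub>C x) ` closure S \<subseteq> closure S"
    proof (rule image_closure_subset)
      show "(\<lambda>x. c *\<^sub>C x) ` S \<subseteq> closure S"
        using assms closure_subset by (fastforce simp: csubspace_scaleC)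
    qed (auto intro: linear_continuous_on bounded_linear_scaleC)
    with that show ?thesis by blast
  qed
  moreover have "subspace (closure S)"
  proof (rule subspaceI)
    show "0 \<in> closure S"
      using assms closure_subset csubspace_0 by blast
    show "x + y \<in> closure S" if "x \<in> closure S" "y \<in> closure S" for x y
    proof -
      \<comment> \<open>Addition is treated as one continuous map on the product, where
        \<open>closure (S \<times> S)\<close> is
        \<open>closure S \<times> closure S\<close>.\<close>
      have "(\<lambda>z. fst z + snd z) ` closure (S \<times> S) \<subseteq> closure S"
      proof (rule image_closure_subset)
        show "(\<lambda>z. fst z + snd z) ` (S \<times> S) \<subseteq> closure S"
          using assms closure_subset by (fastforce simp: csubspace_add)
      qed (auto intro!: continuous_intros)
      with that show ?thesis
        by (auto simp: closure_Times image_subset_iff)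
    qed
    show "r *\<^sub>R x \<in> closure S" if "x \<in> closure S" for r x
      using \<open>\<And>c x. x \<in> closure S \<Longrightarrow> c *\<^sub>C x \<in> closure S\<close>[OF that, of "complex_of_real r"]
      by (simp add: scaleC_of_real)
  qed
  ultimately show ?thesis
    by (simp add: csubspace_def)
qed

section \<open>Bounded complex-linear operators\<close>

lemma bounded_clinear_imp_bounded_linear: "bounded_clinear T \<Longrightarrow> bounded_linear T"
  by (simp add: bounded_clinear_def)

lemma bounded_clinear_add: "bounded_clinear T \<Longrightarrow> T (x + y) = T x + T y"
  and bounded_clinear_diff: "bounded_clinear T \<Longrightarrow> T (x - y) = T x - T y"
  and bounded_clinear_zero: "bounded_clinear T \<Longrightarrow> T 0 = 0"
  and bounded_clinear_scaleC: "bounded_clinear T \<Longrightarrow> T (c *\<^sub>C x) = c *\<^sub>C T x"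
  by (auto simp: bounded_clinear_def linear_add linear_diff linear_0 bounded_linear.linear)

lemma bounded_clinearI:
  assumes "\<And>x y. T (x + y) = T x + T y" "\<And>c x. T (c *\<^sub>C x) = c *\<^sub>C T x"
    and "\<And>x. norm (T x) \<le> norm x * M"
  shows "bounded_clinear T"
  unfolding bounded_clinear_def
  using assms by (auto intro!: bounded_linear_intro simp flip: scaleC_of_real)

lemma bounded_clinear_compose:
  "bounded_clinear T \<Longrightarrow> bounded_clinear R \<Longrightarrow> bounded_clinear (\<lambda>x. T (R x))"
  by (auto simp: bounded_clinear_def intro: bounded_linear_compose)

lemma bounded_clinear_Pair:
  "bounded_clinear T \<Longrightarrow> bounded_clinear R \<Longrightarrow> bounded_clinear (\<lambda>x. (T x, R x))"
  by (auto simp: bounded_clinear_def scaleC_prod_def intro: bounded_linear_Pair)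

lemma bounded_clinear_const_0: "bounded_clinear (\<lambda>x. 0)"
  by (simp add: bounded_clinear_def)

lemma csubspace_range: "bounded_clinear T \<Longrightarrow> csubspace (range T)"
  by (rule csubspaceI)
    (auto simp: image_iff simp flip: bounded_clinear_add bounded_clinear_scaleC
      intro: bounded_clinear_zero)

text \<open>
  The minimizer of \<open>\<parallel>x\<parallel>\<^sup>2 - 2 f x\<close> gives both the Riesz representation of \<open>f\<close> and, for
  \<open>f = inner z\<close>, the orthogonal projection of \<open>z\<close>.
\<close>

lemma riesz_on_closed_subspace:
  fixes f :: "'a::{real_inner,complete_space} \<Rightarrow> real"
  assumes f: "bounded_linear f" and "closed N" and N: "subspace N"
  obtains p where "p \<in> N" "\<And>w. w \<in> N \<Longrightarrow> inner p w = f w"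
proof -
  interpret f: bounded_linear f by fact
  define q where "q x = (norm x)\<^sup>2 - 2 * f x" for x
  define m where "m = Inf (q ` N)"
  obtain C where C: "\<And>x. norm (f x) \<le> norm x * C"
    using f.bounded by blast
  \<comment> \<open>Completing the square: \<open>q x\<close> is at least
    \<open>(norm x - C)\<^sup>2 - C\<^sup>2\<close>.\<close>
  have "- C\<^sup>2 \<le> q x" for x
  proof -
    have "f x \<le> norm x * C"
      using C[of x] by simp
    moreover have "0 \<le> (norm x - C)\<^sup>2" by simp
    ultimately show ?thesis
      by (simp add: q_def power2_diff)
  qed
  then have bdd: "bdd_below (q ` N)"
    by (meson bdd_belowI2)
  have ne: "q ` N \<noteq> {}"
    using N subspace_0 by blast
  have m_le: "m \<le> q x" if "x \<in> N" for x
    unfolding m_def using bdd that by (simp add: cINF_lower)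
  have "\<exists>x\<in>N. q x < m + 1 / real (Suc n)" for n
    using cInf_lessD[OF ne, of "m + 1 / real (Suc n)"] by (auto simp: m_def)
  then obtain X where XN: "X n \<in> N" and Xq: "q (X n) < m + 1 / real (Suc n)" for n
    by metis
  \<comment> \<open>The parallelogram law; the linear terms in \<open>f\<close> cancel because the
    midpoint enters with factor 4.\<close>
  have par: "(norm (x - y))\<^sup>2 = 2 * q x + 2 * q y - 4 * q ((1/2) *\<^sub>R (x + y))" for x y
    unfolding q_def f.scaleR f.add power2_norm_eq_inner
    by (simp add: inner_add_left inner_add_right inner_diff_left inner_diff_right
        inner_commute algebra_simps)
  \<comment> \<open>The midpoint stays in \<open>N\<close>, so its \<open>q\<close> is at least
    \<open>m\<close>; the infimum cancels and only the two errors remain, each with factor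
    2.\<close>
  have dist: "(norm (X k - X l))\<^sup>2 \<le> 4 / real (Suc n)" if "n \<le> k" "n \<le> l" for k l n
  proof -
    have "(1/2) *\<^sub>R (X k + X l) \<in> N"
      using N XN by (simp add: subspace_add subspace_scale)
    then have "m \<le> q ((1/2) *\<^sub>R (X k + X l))" by (rule m_le)
    moreover have "1 / real (Suc k) \<le> 1 / real (Suc n)" "1 / real (Suc l) \<le> 1 / real (Suc n)"
      using that by (simp_all add: frac_le)
    ultimately show ?thesis
      using par[of "X k" "X l"] Xq[of k] Xq[of l] by linarith
  qed
  have "Cauchy X"
  proof (rule CauchyI)
    fix e :: real assume "0 < e"
    then obtain n where "1 / real (Suc n) < e\<^sup>2 / 4"
      using nat_approx_posE[of "e\<^sup>2 / 4"] by auto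
    then have n: "4 / real (Suc n) < e\<^sup>2" by simp
    have "norm (X k - X l) < e" if "n \<le> k" "n \<le> l" for k l
      using dist[OF that] n \<open>0 < e\<close> by (intro power2_less_imp_less[of _ e]) auto
    then show "\<exists>M. \<forall>k\<ge>M. \<forall>l\<ge>M. norm (X k - X l) < e" by blast
  qed
  then obtain p where p: "X \<longlonglongrightarrow> p"
    using Cauchy_convergent convergent_def by blast
  have pN: "p \<in> N"
    using \<open>closed N\<close> XN p closed_sequentially by blast
  \<comment> \<open>Continuity of \<open>q\<close> shows that the limit of the minimizing sequence
    attains the infimum.\<close>
  have "(\<lambda>n. q (X n)) \<longlonglongrightarrow> q p"
    unfolding q_def by (intro tendsto_intros f.tendsto p)
  moreover have "(\<lambda>n. m + 1 / real (Suc n)) \<longlonglongrightarrow> m + 0"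
    by (intro tendsto_add tendsto_const LIMSEQ_Suc lim_1_over_n)
  ultimately have qp: "q p \<le> m"
    using Xq by (intro LIMSEQ_le[of "\<lambda>n. q (X n)" _ "\<lambda>n. m + 1 / real (Suc n)"])
      (auto intro: less_imp_le)
  have "inner p w = f w" if "w \<in> N" for w
  proof (cases "w = 0")
    case False
    define d where "d = inner p w - f w"
    \<comment> \<open>This \<open>t\<close> minimizes the quadratic polynomial
      \<open>q (p + t *\<^sub>R w)\<close>. The decrease below \<open>q p\<close> is
      \<open>d\<^sup>2 / (norm w)\<^sup>2\<close>, which minimality of \<open>p\<close> forces to
      vanish.\<close>
    define t where "t = - d / (norm w)\<^sup>2"
    have "p + t *\<^sub>R w \<in> N"
      using N pN that by (simp add: subspace_add subspace_scale)
    then have "q p \<le> q (p + t *\<^sub>R w)"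
      using qp m_le by force
    also have "q (p + t *\<^sub>R w) = q p + 2 * t * d + t\<^sup>2 * (norm w)\<^sup>2"
      unfolding q_def d_def f.add f.scaleR power2_norm_eq_inner
      by (simp add: inner_add_left inner_add_right inner_commute algebra_simps power2_eq_square)
    also have "\<dots> = q p - d\<^sup>2 / (norm w)\<^sup>2"
      using False by (simp add: t_def field_simps power2_eq_square)
    finally have "d\<^sup>2 / (norm w)\<^sup>2 \<le> 0" by simp
    then show ?thesis
      using False by (simp add: d_def divide_le_0_iff)
  qed (simp add: f.zero)
  with pN that show thesis by blast
qed

text \<open>Testing the real identity at \<open>\<i> *\<^sub>C w\<close> as well yields the
  imaginary parts. This upgrades representations by the real inner product to complex ones.\<close>

lemma cinner_eq_on_csubspace:
  assumes "csubspace N" "\<And>w. w \<in> N \<Longrightarrow> inner x w = Re (g w)"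
    and "\<And>c w. w \<in> N \<Longrightarrow> g (c *\<^sub>C w) = cnj c * g w" "w \<in> N"
  shows "cinner x w = g w"
proof -
  have "inner x (\<i> *\<^sub>C w) = Im (g w)"
    using assms(2)[of "\<i> *\<^sub>C w"] assms by (simp add: csubspace_scaleC)
  then show ?thesis
    using assms(2)[of w] assms(4) by (simp add: cinner_eq_inner complex_eq_iff)
qed

section \<open>Orthogonal projections and complements\<close>

lemma orth_projection_unique:
  assumes "csubspace N" "p \<in> N" "\<And>w. w \<in> N \<Longrightarrow> cinner (z - p) w = 0"
  shows "orth_projection N z = p"
  unfolding orth_projection_def
proof (rule the_equality)
  fix p' assume p': "p' \<in> N \<and> (\<forall>w\<in>N. cinner (z - p') w = 0)"
  then have "p' - p \<in> N"
    using assms csubspace_diff by blast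
  then have "cinner (z - p) (p' - p) - cinner (z - p') (p' - p) = 0"
    using p' assms(3) by simp
  then show "p' = p"
    by (simp flip: cinner_diff_left)
qed (use assms in auto)

text \<open>The vector representing \<open>inner z\<close> on \<open>N\<close> has the same real
  inner products with \<open>N\<close> as \<open>z\<close>, hence the same complex ones.\<close>

lemma
  fixes N :: "'a::chilbert_space set"
  assumes N: "closed N" "csubspace N"
  shows orth_projection_in: "orth_projection N z \<in> N"
    and orth_projection_orthogonal: "w \<in> N \<Longrightarrow> cinner (z - orth_projection N z) w = 0"
proof -
  obtain p where p: "p \<in> N" "\<And>w. w \<in> N \<Longrightarrow> inner p w = inner z w"
    using riesz_on_closed_subspace[of "inner z" N] N bounded_linear_inner_right
    unfolding csubspace_def by metis
  have "cinner p w = cinner z w" if "w \<in> N" for w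
    using N(2) _ _ that
    by (rule cinner_eq_on_csubspace[where g = "cinner z"])
      (simp_all add: p(2) Re_cinner cinner_scaleC_right)
  then have "orth_projection N z = p" and "w \<in> N \<Longrightarrow> cinner (z - p) w = 0" for w
    using p N by (auto intro!: orth_projection_unique simp: cinner_diff_left)
  with p show "orth_projection N z \<in> N" "w \<in> N \<Longrightarrow> cinner (z - orth_projection N z) w = 0"
    by auto
qed

text \<open>Pythagoras for the orthogonal decomposition of \<open>z\<close> into its projection and
  the residual.\<close>

lemma norm_orth_projection_le:
  fixes N :: "'a::chilbert_space set"
  assumes N: "closed N" "csubspace N"
  shows "norm (orth_projection N z) \<le> norm z"
proof -
  let ?p = "orth_projection N z"
  have "cinner (z - ?p) ?p = 0"
    by (intro orth_projection_orthogonal orth_projection_in N)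
  then have "inner (z - ?p) ?p = 0"
    by (simp flip: Re_cinner)
  then have "(norm z)\<^sup>2 = (norm (z - ?p))\<^sup>2 + (norm ?p)\<^sup>2"
    using norm_add_Pythagorean[of "z - ?p" ?p] by (simp add: orthogonal_def)
  then have "(norm ?p)\<^sup>2 \<le> (norm z)\<^sup>2"
    by simp
  then show ?thesis
    by (rule power2_le_imp_le) simp
qed

text \<open>Sums and multiples of projections satisfy the characterization that determines the
  projection uniquely.\<close>

lemma bounded_clinear_orth_projection:
  fixes N :: "'a::chilbert_space set"
  assumes N: "closed N" "csubspace N"
  shows "bounded_clinear (orth_projection N)"
proof (rule bounded_clinearI)
  note P = orth_projection_in[OF N] orth_projection_orthogonal[OF N]
  show "orth_projection N (x + y) = orth_projection N x + orth_projection N y" for x y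
  proof (rule orth_projection_unique[OF N(2)])
    fix w assume "w \<in> N"
    then have "cinner (x - orth_projection N x) w + cinner (y - orth_projection N y) w = 0"
      by (simp add: P)
    then show "cinner (x + y - (orth_projection N x + orth_projection N y)) w = 0"
      by (simp add: cinner_add_left cinner_diff_left algebra_simps)
  qed (simp add: P N csubspace_add)
  show "orth_projection N (c *\<^sub>C x) = c *\<^sub>C orth_projection N x" for c x
    by (rule orth_projection_unique[OF N(2)])
      (auto simp: P N csubspace_scaleC cinner_scaleC_left simp flip: scaleC_diff_right)
  show "norm (orth_projection N x) \<le> norm x * 1" for x
    by (simp add: norm_orth_projection_le N)
qed

text \<open>The complement is \<open>K\<close> intersected with zero sets of continuous linear
  functionals.\<close>

lemma
  assumes K: "csubspace K"
  shows csubspace_orth_compl_on: "csubspace (orth_compl_on K M)"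
    and closed_orth_compl_on: "closed K \<Longrightarrow> closed (orth_compl_on K M)"
proof -
  show "csubspace (orth_compl_on K M)"
    using K by (intro csubspaceI)
      (auto simp: orth_compl_on_def csubspace_0 csubspace_add csubspace_scaleC
        cinner_add_left cinner_scaleC_left)
  have "orth_compl_on K M = K \<inter> (\<Inter>w\<in>M. {z. cinner z w = 0})"
    by (auto simp: orth_compl_on_def)
  then show "closed (orth_compl_on K M)" if "closed K"
    using that
    by (simp only:) (intro closed_Int closed_INT ballI closed_Collect_eq
        continuous_on_cinner_left continuous_on_const)
qed

text \<open>The nontrivial half of the double complement theorem, relative to \<open>K\<close>. The
  residual of projecting \<open>z\<close> onto \<open>closure M\<close> lies in the complement, so
  it is orthogonal to \<open>z\<close> and to the projection, hence to itself.\<close>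

lemma in_closure_if_orthogonal_to_compl:
  fixes K :: "'a::chilbert_space set"
  assumes K: "csubspace K" "closed K" and M: "csubspace M" "M \<subseteq> K"
    and z: "z \<in> K" "\<And>w. w \<in> orth_compl_on K M \<Longrightarrow> cinner z w = 0"
  shows "z \<in> closure M"
proof -
  note cl = closed_closure csubspace_closure[OF M(1)]
  let ?r = "orth_projection (closure M) z"
  have r: "?r \<in> closure M" "\<And>w. w \<in> closure M \<Longrightarrow> cinner (z - ?r) w = 0"
    using orth_projection_in[OF cl] orth_projection_orthogonal[OF cl] by auto
  have "?r \<in> K"
    using r(1) M(2) K(2) closure_minimal by blast
  then have "z - ?r \<in> orth_compl_on K M"
    using r(2) z(1) K(1) closure_subset by (auto simp: orth_compl_on_def csubspace_diff)
  then have "cinner z (z - ?r) = 0" by (rule z(2))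
  moreover have "cinner ?r (z - ?r) = 0"
    using cinner_orthogonal_sym[OF r(2)[OF r(1)]] .
  ultimately have "cinner (z - ?r) (z - ?r) = 0"
    by (simp add: cinner_diff_left)
  then show ?thesis
    using r(1) by simp
qed

section \<open>Adjoints and operators given by a form\<close>

text \<open>Linearity follows by pairing with arbitrary vectors. The bound comes from
  \<open>(norm (T x))\<^sup>2 = inner x (S (T x))\<close> by Cauchy-Schwarz and division by
  \<open>norm (T x)\<close>.\<close>

lemma bounded_clinear_if_adjoint:
  assumes S: "bounded_clinear S" and T: "\<And>z w. cinner (T z) w = cinner z (S w)"
  shows "bounded_clinear T"
proof -
  obtain M where M: "0 \<le> M" "\<And>x. norm (S x) \<le> norm x * M"
    using bounded_linear.nonneg_bounded[OF bounded_clinear_imp_bounded_linear[OF S]] by blast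
  show ?thesis
  proof (rule bounded_clinearI)
    show "T (x + y) = T x + T y" for x y
      by (rule cinner_ext) (simp add: T cinner_add_left)
    show "T (c *\<^sub>C x) = c *\<^sub>C T x" for c x
      by (rule cinner_ext) (simp add: T cinner_scaleC_left)
    show "norm (T x) \<le> norm x * M" for x
    proof -
      have "(norm (T x))\<^sup>2 = inner x (S (T x))"
        using T[of x "T x"] by (simp add: power2_norm_eq_inner flip: Re_cinner)
      also have "\<dots> \<le> norm x * norm (S (T x))"
        by (rule norm_cauchy_schwarz)
      also have "\<dots> \<le> norm x * (norm (T x) * M)"
        by (intro mult_left_mono M) auto
      finally have "norm (T x) * norm (T x) \<le> norm (T x) * (norm x * M)"
        by (simp add: power2_eq_square algebra_simps)
      then show ?thesis
        using M(1) by (cases "T x = 0") auto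
    qed
  qed
qed

text \<open>Riesz representation on the whole space, applied for each \<open>z\<close> to the
  functional \<open>inner z (S w)\<close> of \<open>w\<close>.\<close>

lemma adjoint_exists:
  fixes S :: "'a::chilbert_space \<Rightarrow> 'b::complex_inner"
  assumes S: "bounded_clinear S"
  obtains T where "bounded_clinear T" "\<And>z w. cinner (T z) w = cinner z (S w)"
proof -
  have "\<exists>t. \<forall>w. cinner t w = cinner z (S w)" for z
  proof -
    have "bounded_linear (\<lambda>w. inner z (S w))"
      using S by (intro bounded_linear_compose[OF bounded_linear_inner_right])
        (rule bounded_clinear_imp_bounded_linear)
    then obtain t where "\<And>w. inner t w = inner z (S w)"
      using riesz_on_closed_subspace[of "\<lambda>w. inner z (S w)" UNIV] by auto
    then have "cinner t w = cinner z (S w)" for w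
      by (intro cinner_eq_on_csubspace[OF csubspace_UNIV, where g = "\<lambda>w. cinner z (S w)"])
        (simp_all add: Re_cinner bounded_clinear_scaleC[OF S] cinner_scaleC_right)
    then show ?thesis by blast
  qed
  then obtain T where "\<And>z w. cinner (T z) w = cinner z (S w)"
    by metis
  with bounded_clinear_if_adjoint[OF S] that show thesis by blast
qed

text \<open>Two candidate values differ by an element of \<open>K\<close>; testing the adjoint
  relation on that difference shows that it is zero.\<close>

lemma adjoint_on_eq:
  assumes K: "csubspace K" and S: "\<And>y. S y \<in> K"
    and adj: "\<And>y z. z \<in> K \<Longrightarrow> cinner (T z) y = cinner z (S y)"
  shows "adjoint_on K T = S"
  unfolding adjoint_on_def
proof (rule the_equality)
  fix S' assume S': "\<forall>y. S' y \<in> K \<and> (\<forall>z\<in>K. cinner (T z) y = cinner z (S' y))"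
  show "S' = S"
  proof
    fix y
    have d: "S' y - S y \<in> K"
      using S' S K csubspace_diff by blast
    then have "cinner (S' y - S y) (S' y) = cinner (S' y - S y) (S y)"
      using S' adj by metis
    then have "cinner (S' y - S y) (S' y - S y) = 0"
      by (simp add: cinner_diff_right)
    then show "S' y = S y" by simp
  qed
qed (use S adj in auto)

text \<open>The form forces \<open>D\<close> to be the adjoint of \<open>R\<close> composed with
  \<open>R\<close>. Boundedness and linearity of a product of operators can thus be read off from
  its form alone.\<close>

lemma bounded_clinear_form:
  fixes R :: "'a::chilbert_space \<Rightarrow> 'b::complex_inner"
  assumes R: "bounded_clinear R" and D: "\<And>x y. cinner (D x) y = cinner (R x) (R y)"
  shows "bounded_clinear D"
proof -
  obtain T where T: "bounded_clinear T" "\<And>z w. cinner (T z) w = cinner z (R w)"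
    using adjoint_exists[OF R] by blast
  have "D x = T (R x)" for x
    by (rule cinner_ext) (simp add: D T)
  then have "D = (\<lambda>x. T (R x))"
    by (rule ext)
  then show ?thesis
    using bounded_clinear_compose[OF T(1) R] by simp
qed

section \<open>Completions of operator ranges\<close>

text \<open>The isometry gives \<open>(norm (i (A x)))\<^sup>2 = inner (A x) x\<close>, at most
  \<open>M * (norm x)\<^sup>2\<close>; hence the bound \<open>sqrt M\<close>.\<close>

lemma bounded_clinear_range_completion:
  assumes A: "bounded_clinear A" and i: "range_completion A i HA"
  shows "bounded_clinear (\<lambda>x. i (A x))"
proof -
  obtain M where M: "\<And>x. norm (A x) \<le> norm x * M" "0 \<le> M"
    using bounded_linear.nonneg_bounded[OF bounded_clinear_imp_bounded_linear[OF A]] by blast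
  have lin: "clinear_on (range A) i" and iso: "\<And>x y. cinner (i (A x)) (i (A y)) = cinner (A x) y"
    using i by (auto simp: range_completion_def)
  show ?thesis
  proof (rule bounded_clinearI)
    show "i (A (x + y)) = i (A x) + i (A y)" for x y
      using lin by (simp add: clinear_on_def bounded_clinear_add[OF A])
    show "i (A (c *\<^sub>C x)) = c *\<^sub>C i (A x)" for c x
      using lin by (simp add: clinear_on_def bounded_clinear_scaleC[OF A])
    show "norm (i (A x)) \<le> norm x * sqrt M" for x
    proof (rule power2_le_imp_le)
      have "(norm (i (A x)))\<^sup>2 = inner (A x) x"
        using iso[of x x] by (simp add: power2_norm_eq_inner flip: Re_cinner)
      also have "\<dots> \<le> norm (A x) * norm x"
        by (rule norm_cauchy_schwarz)
      also have "\<dots> \<le> norm x * M * norm x"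
        by (intro mult_right_mono M) auto
      finally show "(norm (i (A x)))\<^sup>2 \<le> (norm x * sqrt M)\<^sup>2"
        using M(2) by (simp add: power_mult_distrib) (simp add: power2_eq_square algebra_simps)
    qed (simp add: M)
  qed
qed

lemma range_completion_eq: "range_completion A i HA \<Longrightarrow> HA = closure (range (\<lambda>x. i (A x)))"
  by (simp add: range_completion_def image_image)

lemma
  assumes "bounded_clinear A" "range_completion A i HA"
  shows csubspace_range_completion: "csubspace HA"
    and closed_range_completion: "closed HA"
    and in_range_completion: "i (A x) \<in> HA"
  using csubspace_closure[OF csubspace_range[OF bounded_clinear_range_completion[OF assms]]]
    closure_subset[of "range (\<lambda>x. i (A x))"]
  by (auto simp: range_completion_eq[OF assms(2)])

text \<open>Any competitor agrees with \<open>T\<close> on a dense subset of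
  \<open>HA \<times> HB\<close>, hence on all of it by continuity, and off it by
  extensionality.\<close>

lemma cont_linear_ext_eq:
  assumes A: "bounded_clinear A" "range_completion A i HA"
    and B: "bounded_clinear B" "range_completion B j HB"
    and T: "bounded_clinear T" "\<And>x y. T (i (A x), j (B y)) = f x y"
  shows "cont_linear_ext A i HA B j HB f = restrict T (HA \<times> HB)"
  unfolding cont_linear_ext_def
proof (rule the_equality)
  have K: "csubspace (HA \<times> HB)"
    by (intro csubspace_Times csubspace_range_completion[OF A] csubspace_range_completion[OF B])
  have cont: "continuous_on (HA \<times> HB) (restrict T (HA \<times> HB))"
    using linear_continuous_on[OF bounded_clinear_imp_bounded_linear[OF T(1)]]
    by (rule continuous_on_eq) simp
  have val: "restrict T (HA \<times> HB) (i (A x), j (B y)) = f x y" for x y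
    using in_range_completion[OF A] in_range_completion[OF B] T(2) by simp
  have lin: "clinear_on (HA \<times> HB) (restrict T (HA \<times> HB))"
    unfolding clinear_on_def
    by (simp add: csubspace_add[OF K] csubspace_scaleC[OF K] bounded_clinear_add[OF T(1)]
        bounded_clinear_scaleC[OF T(1)] del: mem_Times_iff split_paired_All)
  show "restrict T (HA \<times> HB) \<in> extensional (HA \<times> HB) \<and>
      clinear_on (HA \<times> HB) (restrict T (HA \<times> HB)) \<and>
      continuous_on (HA \<times> HB) (restrict T (HA \<times> HB)) \<and>
      (\<forall>x y. restrict T (HA \<times> HB) (i (A x), j (B y)) = f x y)"
    using cont val lin by auto
  fix T' assume T': "T' \<in> extensional (HA \<times> HB) \<and> clinear_on (HA \<times> HB) T' \<and>
      continuous_on (HA \<times> HB) T' \<and> (\<forall>x y. T' (i (A x), j (B y)) = f x y)"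
  let ?M = "range (\<lambda>x. i (A x)) \<times> range (\<lambda>x. j (B x))"
  have cl: "closure ?M = HA \<times> HB"
    by (simp add: closure_Times flip: range_completion_eq[OF A(2)] range_completion_eq[OF B(2)])
  show "T' = restrict T (HA \<times> HB)"
  proof (rule extensionalityI[of _ "HA \<times> HB"])
    fix z assume z: "z \<in> HA \<times> HB"
    have "T' z - restrict T (HA \<times> HB) z = 0"
    proof (rule continuous_constant_on_closure[of ?M])
      show "continuous_on (closure ?M) (\<lambda>z. T' z - restrict T (HA \<times> HB) z)"
        unfolding cl using T' cont by (blast intro: continuous_on_diff)
      show "z \<in> closure ?M"
        using z by (simp only: cl)
      show "T' x - restrict T (HA \<times> HB) x = 0" if "x \<in> ?M" for x
        using that T' val by (auto simp del: restrict_apply)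
    qed
    then show "T' z = restrict T (HA \<times> HB) z"
      by simp
  qed (use T' in auto)
qed

text \<open>
  The extension is constructed as the adjoint of the operator that is to be its adjoint, which
  gives linearity and continuity on the whole space without an extension argument.
\<close>

lemma
  assumes A: "bounded_clinear A" "range_completion A i HA"
    and B: "bounded_clinear B" "range_completion B j HB"
    and S: "bounded_clinear S" "\<And>w. S w \<in> HA \<times> HB"
    and f: "\<And>x y w. cinner (f x y) w = cinner (i (A x), j (B y)) (S w)"
  shows cinner_cont_linear_ext:
      "z \<in> HA \<times> HB \<Longrightarrow> cinner (cont_linear_ext A i HA B j HB f z) w = cinner z (S w)"
    and adjoint_cont_linear_ext:
      "adjoint_on (HA \<times> HB) (cont_linear_ext A i HA B j HB f) = S"
proof -
  obtain T where T: "bounded_clinear T" "\<And>z w. cinner (T z) w = cinner z (S w)"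
    using adjoint_exists[OF S(1)] by blast
  \<comment> \<open>By the hypothesis on \<open>f\<close>, both sides have the same inner product
    with every \<open>w\<close>.\<close>
  have "T (i (A x), j (B y)) = f x y" for x y
    by (rule cinner_ext) (simp add: T f)
  then have "cont_linear_ext A i HA B j HB f = restrict T (HA \<times> HB)"
    by (rule cont_linear_ext_eq[OF A B T(1)])
  then have *: "cinner (cont_linear_ext A i HA B j HB f z) w = cinner z (S w)"
    if "z \<in> HA \<times> HB" for z w
    using that by (simp add: T)
  then show "z \<in> HA \<times> HB \<Longrightarrow> cinner (cont_linear_ext A i HA B j HB f z) w = cinner z (S w)" .
  show "adjoint_on (HA \<times> HB) (cont_linear_ext A i HA B j HB f) = S"
    by (intro adjoint_on_eq csubspace_Times csubspace_range_completion[OF A]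
        csubspace_range_completion[OF B] S(2) *)
qed

section \<open>Equality of the two products and their common quadratic form\<close>

theorem theorem2p1:
  fixes A B :: "'h::chilbert_space \<Rightarrow> 'h"
    and i :: "'h \<Rightarrow> 'ka::chilbert_space" and HA :: "'ka set"
    and j :: "'h \<Rightarrow> 'kb::chilbert_space" and HB :: "'kb set"
  assumes "bounded_clinear A" and "positive_operator A"
    and "bounded_clinear B" and "positive_operator B"
    and "range_completion A i HA"
    and "range_completion B j HB"
  shows "bounded_clinear (JPJ_A A i HA B j HB) \<and> positive_operator (JPJ_A A i HA B j HB) \<and>
         bounded_clinear (JPJ_B A i HA B j HB) \<and> positive_operator (JPJ_B A i HA B j HB) \<and>
         (\<forall>x. quadratic_form (JPJ_A A i HA B j HB) x =
            complex_of_real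
              (INF y. Re (quadratic_form A (x - y) + quadratic_form B y))) \<and>
         (\<forall>x. quadratic_form (JPJ_B A i HA B j HB) x =
            complex_of_real
              (INF y. Re (quadratic_form A (x - y) + quadratic_form B y))) \<and>
         JPJ_A A i HA B j HB = JPJ_B A i HA B j HB"
proof -
  note A = assms(1,5) and B = assms(3,6)
  define V where "V x = i (A x)" for x
  define W where "W x = j (B x)" for x
  define S where "S x = (V x, W x)" for x
  define SA where "SA x = (V x, 0::'kb)" for x
  define SB where "SB x = (0::'ka, W x)" for x
  define K where "K = HA \<times> HB"
  define N where "N = orth_compl_on K (range S)"
  define P where "P = orth_projection N"
  define D where "D = JPJ_A A i HA B j HB"
  have V: "bounded_clinear V" and W: "bounded_clinear W"
    unfolding V_def W_def using bounded_clinear_range_completion A B by blast+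
  \<comment> \<open>Isometry turns the quadratic forms of \<open>A\<close> and \<open>B\<close> into
    the squared norms of \<open>V\<close> and \<open>W\<close>.\<close>
  have VV: "cinner (V x) (V y) = cinner (A x) y" and WW: "cinner (W x) (W y) = cinner (B x) y"
    for x y using A(2) B(2) by (auto simp: range_completion_def V_def W_def)
  have S: "bounded_clinear S" and SA: "bounded_clinear SA" and SB: "bounded_clinear SB"
    unfolding S_def SA_def SB_def
    by (intro bounded_clinear_Pair bounded_clinear_const_0 V W)+
  have K: "csubspace K" "closed K"
    unfolding K_def by (intro csubspace_Times closed_Times csubspace_range_completion[OF A]
        csubspace_range_completion[OF B] closed_range_completion[OF A] closed_range_completion[OF B])+
  have SK: "S x \<in> K" "SA x \<in> K" "SB x \<in> K" for x
    unfolding S_def SA_def SB_def K_def V_def W_def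
    using in_range_completion[OF A] in_range_completion[OF B]
      csubspace_0[OF csubspace_range_completion[OF A]]
      csubspace_0[OF csubspace_range_completion[OF B]] by auto

  \<comment> \<open>The three operators into \<open>H\<close> and their adjoints\<close>
  have "adjoint_on K (J_op A i HA B j HB) = S"
    unfolding K_def J_op_def using SK(1)
    by (intro adjoint_cont_linear_ext[OF A B S])
      (auto simp: K_def S_def cinner_prod_def VV WW cinner_add_left simp flip: V_def W_def)
  then have P_op: "P_op A i HA B j HB = P"
    by (simp add: P_op_def P_def N_def K_def)
  have formA: "cinner (A x) w = cinner (i (A x), j (B y)) (SA w)"
    and formB: "cinner (B y) w = cinner (i (A x), j (B y)) (SB w)" for x y w
    by (simp_all add: cinner_prod_def SA_def SB_def VV WW flip: V_def W_def)
  have JA: "adjoint_on K (JA_op A i HA B j HB) = SA"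
    and JA': "\<And>z w. z \<in> K \<Longrightarrow> cinner (JA_op A i HA B j HB z) w = cinner z (SA w)"
    using adjoint_cont_linear_ext[OF A B SA SK(2)[unfolded K_def], of "\<lambda>x y. A x", OF formA]
      cinner_cont_linear_ext[OF A B SA SK(2)[unfolded K_def], of "\<lambda>x y. A x", OF formA]
    by (simp_all add: JA_op_def K_def)
  have JB: "adjoint_on K (JB_op A i HA B j HB) = SB"
    and JB': "\<And>z w. z \<in> K \<Longrightarrow> cinner (JB_op A i HA B j HB z) w = cinner z (SB w)"
    using adjoint_cont_linear_ext[OF A B SB SK(3)[unfolded K_def], of "\<lambda>x y. B y", OF formB]
      cinner_cont_linear_ext[OF A B SB SK(3)[unfolded K_def], of "\<lambda>x y. B y", OF formB]
    by (simp_all add: JB_op_def K_def)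

  \<comment> \<open>The projection onto the complement of the range of \<open>S\<close>\<close>
  have N: "closed N" "csubspace N"
    unfolding N_def using closed_orth_compl_on csubspace_orth_compl_on K by blast+
  have NK: "N \<subseteq> K"
    by (auto simp: N_def orth_compl_on_def)
  have P: "bounded_clinear P"
    unfolding P_def by (rule bounded_clinear_orth_projection[OF N])
  have PN: "P z \<in> N" and PO: "w \<in> N \<Longrightarrow> cinner (z - P z) w = 0" for z w
    unfolding P_def by (auto intro: orth_projection_in orth_projection_orthogonal N)
  have PK: "P z \<in> K" for z
    using PN NK by blast
  \<comment> \<open>The residual \<open>w - P w\<close> is orthogonal to \<open>N\<close>, which
    contains \<open>P z\<close>.\<close>
  have PP: "cinner (P z) w = cinner (P z) (P w)" for z w
  proof -
    have "cinner (P z) (w - P w) = 0"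
      using cinner_orthogonal_sym[OF PO[OF PN]] .
    then show ?thesis
      by (simp add: cinner_diff_right)
  qed
  \<comment> \<open>\<open>N\<close> is by definition orthogonal to the range of \<open>S\<close>,
    so zero satisfies the characterization of the projection.\<close>
  have PS: "P (S x) = 0" for x
    unfolding P_def
  proof (rule orth_projection_unique[OF N(2) csubspace_0[OF N(2)]])
    show "cinner (S x - 0) w = 0" if "w \<in> N" for w
      using that by (auto simp: N_def orth_compl_on_def intro: cinner_orthogonal_sym)
  qed
  have "S x = SA x + SB x" for x
    by (simp add: S_def SA_def SB_def)
  then have PSA: "P (SA x) = - P (SB x)" for x
    using PS[of x] by (simp add: bounded_clinear_add[OF P] eq_neg_iff_add_eq_0)
  \<comment> \<open>The adjoint relation moves the outer operator to the other side, where it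
    becomes \<open>SA y\<close>; \<open>PP\<close> then inserts the second projection.\<close>
  have form: "cinner (D x) y = cinner (P (SA x)) (P (SA y))" for x y
    by (simp add: D_def JPJ_A_def P_op JA JA' PK flip: K_def PP)
  have "cinner (JPJ_B A i HA B j HB x) y = cinner (P (SB x)) (P (SB y))" for x y
    by (simp add: JPJ_B_def P_op JB JB' PK flip: K_def PP)
  \<comment> \<open>Replacing \<open>SB\<close> by \<open>SA\<close> under \<open>P\<close> changes
    the sign in both slots, and the two signs cancel.\<close>
  then have "JPJ_B A i HA B j HB x = D x" for x
    by (intro cinner_ext[of "JPJ_B A i HA B j HB x"])
      (simp add: form PSA cinner_minus_left cinner_minus_right)
  then have eq: "JPJ_B A i HA B j HB = D"
    by (rule ext)
  have bdd: "bounded_clinear D"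
    by (rule bounded_clinear_form[OF bounded_clinear_compose[OF P SA] form])
  have pos: "positive_operator D"
    unfolding positive_operator_def form cinner_self by (simp del: of_real_power)

  \<comment> \<open>The quadratic form as a squared distance to the range of
    \<open>S\<close>\<close>
  have quad: "quadratic_form D x =
      complex_of_real (INF y. Re (quadratic_form A (x - y) + quadratic_form B y))" for x
  proof -
    define g where "g y = (norm (SA x - S y))\<^sup>2" for y
    have g: "Re (quadratic_form A (x - y) + quadratic_form B y) = g y" for y
    proof -
      have "SA x - S y = (V (x - y), - W y)"
        by (simp add: SA_def S_def bounded_clinear_diff[OF V])
      then have "complex_of_real (g y) = cinner (V (x - y)) (V (x - y)) + cinner (W y) (W y)"
        unfolding g_def cinner_self[symmetric]
        by (simp add: cinner_prod_def cinner_minus_left cinner_minus_right)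
      also have "\<dots> = quadratic_form A (x - y) + quadratic_form B y"
        by (simp add: VV WW quadratic_form_def)
      finally show ?thesis
        by (metis Re_complex_of_real)
    qed
    have "Inf (range g) = (norm (P (SA x)))\<^sup>2"
    proof (rule cInf_eq)
      fix r assume "r \<in> range g"
      then obtain y where y: "r = g y" by blast
      \<comment> \<open>Subtracting \<open>S y\<close> does not change the projection, and
        \<open>P\<close> is a contraction: this gives the lower bound.\<close>
      have "P (SA x) = P (SA x - S y)"
        by (simp add: bounded_clinear_diff[OF P] PS)
      then have "norm (P (SA x)) \<le> norm (SA x - S y)"
        using norm_orth_projection_le[OF N] by (simp add: P_def)
      then show "(norm (P (SA x)))\<^sup>2 \<le> r"
        by (simp add: y g_def power_mono)
    next
      fix r assume r: "\<And>u. u \<in> range g \<Longrightarrow> r \<le> u"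
      \<comment> \<open>This residual is orthogonal to \<open>N\<close>, the complement of
        \<open>range S\<close> in \<open>K\<close>. Approximating it from \<open>range S\<close>
        makes values of \<open>g\<close> converge to \<open>(norm (P (SA x)))\<^sup>2\<close>, so no
        lower bound exceeds that number.\<close>
      have "SA x - P (SA x) \<in> closure (range S)"
      proof (rule in_closure_if_orthogonal_to_compl[OF K csubspace_range[OF S]])
        show "SA x - P (SA x) \<in> K"
          by (intro csubspace_diff K SK PK)
      qed (use SK(1) PO N_def in auto)
      then obtain s where s: "\<And>n. s n \<in> range S" "s \<longlonglongrightarrow> SA x - P (SA x)"
        unfolding closure_sequential by blast
      have "(\<lambda>n. (norm (SA x - s n))\<^sup>2) \<longlonglongrightarrow> (norm (SA x - (SA x - P (SA x))))\<^sup>2"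
        by (intro tendsto_intros s)
      moreover have "r \<le> (norm (SA x - s n))\<^sup>2" for n
        using s(1)[of n] r by (auto simp: g_def)
      ultimately show "r \<le> (norm (P (SA x)))\<^sup>2"
        by (auto intro: LIMSEQ_le_const)
    qed
    then show ?thesis
      by (simp only: g) (simp add: quadratic_form_def form cinner_self)
  qed
  show ?thesis
    using bdd pos quad by (simp add: eq flip: D_def)
qed

end
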